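(* There exist a constant $c>0$ and bipartite graphs $G$ with $\tau(G)$ arbitrarily large such that $\overrightarrow{\tau}(G)\ge c\,\dfrac{\tau(G)\log \tau(G)}{\log\log \tau(G)}$; that is, there are bipartite graphs with $\overrightarrow{\tau}(G)=\Omega\!\left(\frac{\tau(G)\log\tau(G)}{\log\log\tau(G)}\right)$.
   Context: For a finite graph $G$, $\tau(G)$ is the minimum size of a vertex cover (a set of vertices meeting every edge). For a bijection $\sigma: V(G)\to\{1,\dots,|V(G)|\}$ (an ordering), its cost is $\sum_{e\in E(G)}\min_{v\in e}\sigma(v)$; a minimum sum vertex cover is an ordering of minimum cost. For an ordering $\sigma$, let $S_\sigma$ be the set of vertices $v$ with $\sigma(v)\le \max_{e\in E(G)}\min_{u\in e}\sigma(u)$. Define $\overrightarrow{\tau}(G)=\max\{|S_\sigma| : \sigma \text{ a minimum sum vertex cover of } G\}$. *)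

theory Defs
  imports Complex_Main
begin

definition finite_graph :: "'a set \<Rightarrow> 'a set set \<Rightarrow> bool" where
  "finite_graph V E \<longleftrightarrow> finite V \<and> (\<forall>e\<in>E. e \<subseteq> V \<and> card e = 2)"

definition bipartite_graph :: "'a set \<Rightarrow> 'a set set \<Rightarrow> bool" where
  "bipartite_graph V E \<longleftrightarrow> finite_graph V E \<and>
     (\<exists>A B. A \<union> B = V \<and> A \<inter> B = {} \<and> (\<forall>e\<in>E. \<exists>a\<in>A. \<exists>b\<in>B. e = {a, b}))"

definition vertex_cover :: "'a set \<Rightarrow> 'a set set \<Rightarrow> 'a set \<Rightarrow> bool" where
  "vertex_cover V E S \<longleftrightarrow> S \<subseteq> V \<and> (\<forall>e\<in>E. e \<inter> S \<noteq> {})"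

definition vc_number :: "'a set \<Rightarrow> 'a set set \<Rightarrow> nat" where
  "vc_number V E = Min {card S | S. vertex_cover V E S}"

definition vertex_ordering :: "'a set \<Rightarrow> ('a \<Rightarrow> nat) \<Rightarrow> bool" where
  "vertex_ordering V \<sigma> \<longleftrightarrow> bij_betw \<sigma> V {1..card V}"

definition cover_time :: "('a \<Rightarrow> nat) \<Rightarrow> 'a set \<Rightarrow> nat" where
  "cover_time \<sigma> e = Min (\<sigma> ` e)"

definition ordering_cost :: "'a set set \<Rightarrow> ('a \<Rightarrow> nat) \<Rightarrow> nat" where
  "ordering_cost E \<sigma> = (\<Sum>e\<in>E. cover_time \<sigma> e)"

definition min_sum_vertex_cover :: "'a set \<Rightarrow> 'a set set \<Rightarrow> ('a \<Rightarrow> nat) \<Rightarrow> bool" where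
  "min_sum_vertex_cover V E \<sigma> \<longleftrightarrow> vertex_ordering V \<sigma> \<and>
     (\<forall>\<rho>. vertex_ordering V \<rho> \<longrightarrow> ordering_cost E \<sigma> \<le> ordering_cost E \<rho>)"

(* For E = {} the inner Max ranges over the empty set and is unspecified, as is the
   maximum it transcribes; only graphs with at least one edge are meaningful here. *)
definition used_vertices :: "'a set \<Rightarrow> 'a set set \<Rightarrow> ('a \<Rightarrow> nat) \<Rightarrow> 'a set" where
  "used_vertices V E \<sigma> = {v \<in> V. \<sigma> v \<le> Max (cover_time \<sigma> ` E)}"

(* The values of \<sigma> outside V are unconstrained but irrelevant: the cardinalities
   below depend only on \<sigma> on V and are bounded by card V, so Max is over a finite set. *)
definition msvc_number :: "'a set \<Rightarrow> 'a set set \<Rightarrow> nat" where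
  "msvc_number V E = Max {card (used_vertices V E \<sigma>) | \<sigma>. min_sum_vertex_cover V E \<sigma>}"

end

theory Submission
  imports Defs "HOL-Library.Nat_Bijection"
begin

text \<open>
  The graph has a side \<open>A\<close> of size \<open>32 n\<close> and \<open>t\<close> sides \<open>B j\<close> of size \<open>n = q ^ t\<close>. At level \<open>j\<close>
  everything is cut into blocks, \<open>32 q^j\<close> vertices of \<open>A\<close> facing \<open>q^j\<close> vertices of \<open>B j\<close>, and facing
  blocks are completely joined; blocks of higher levels are unions of blocks of lower ones. Since
  \<open>A\<close> covers all edges and level \<open>0\<close> contains \<open>n\<close> disjoint stars, the cover number lies between
  \<open>n\<close> and \<open>32 n\<close>.

  In an optimal ordering the number of newly covered edges never increases, so it may be split into
  phases, phase \<open>j\<close> ending when it falls below \<open>16 q^j\<close>. While the \<open>B\<close>-blocks facing \<open>a\<close>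
  are exhausted on schedule from the top level down, \<open>a\<close> has too small a residual degree to be chosen.
  If a level-\<open>j\<close> block is the first one not exhausted on schedule, then its remaining \<open>B\<close>-vertices
  can only be used after a quarter of its \<open>A\<close>-side. Pulling them to the front of this window, and
  postponing as many of these \<open>A\<close>-vertices to the very end, costs little for the rest of the ordering because the
  postponed vertices only face lower levels; optimality then bounds the window by a \<open>1/q\<close> fraction
  of the ordering. Hence few vertices of \<open>A\<close> lie in such blocks, and at least half of them keep
  to the schedule at all levels. Those force the ordering to use half of every \<open>B j\<close>, that is
  \<open>t n / 2\<close> vertices. With \<open>q = t^2\<close>, \<open>t\<close> is of order \<open>ln n / ln (ln n)\<close>.
\<close>

section \<open>Orderings as lists\<close>

definition unc :: "'a set set \<Rightarrow> 'a set \<Rightarrow> 'a set set" where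
  "unc E P = {e \<in> E. e \<inter> P = {}}"

text \<open>An edge first met by the \<open>i\<close>-th vertex (counted from \<open>1\<close>) is uncovered at the times
  \<open>0, \<dots>, i - 1\<close>, so this is the cost of the ordering.\<close>

definition list_cost :: "'a set set \<Rightarrow> 'a list \<Rightarrow> nat" where
  "list_cost E xs = (\<Sum>s<length xs. card (unc E (set (take s xs))))"

definition opt_list :: "'a set \<Rightarrow> 'a set set \<Rightarrow> 'a list \<Rightarrow> bool" where
  "opt_list V E xs \<longleftrightarrow> distinct xs \<and> set xs = V \<and>
     (\<forall>ys. distinct ys \<longrightarrow> set ys = V \<longrightarrow> list_cost E xs \<le> list_cost E ys)"

definition gain :: "'a set set \<Rightarrow> 'a list \<Rightarrow> nat \<Rightarrow> nat" where
  "gain E xs s = card {e \<in> unc E (set (take s xs)). xs ! s \<in> e}"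

lemma finite_unc [simp]: "finite E \<Longrightarrow> finite (unc E P)"
  by (simp add: unc_def)

lemma unc_antimono: "P \<subseteq> P' \<Longrightarrow> unc E P' \<subseteq> unc E P"
  by (auto simp: unc_def)

lemma card_unc_antimono: "finite E \<Longrightarrow> P \<subseteq> P' \<Longrightarrow> card (unc E P') \<le> card (unc E P)"
  by (simp add: card_mono unc_antimono)

lemma card_unc_insert:
  assumes "finite E"
  shows "card (unc E P) = card (unc E (insert v P)) + card {e \<in> unc E P. v \<in> e}"
proof -
  have "unc E P = unc E (insert v P) \<union> {e \<in> unc E P. v \<in> e}"
    by (auto simp: unc_def)
  moreover have "unc E (insert v P) \<inter> {e \<in> unc E P. v \<in> e} = {}"
    by (auto simp: unc_def)
  ultimately show ?thesis
    using assms by (metis card_Un_disjoint finite_Un finite_unc)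
qed

lemma set_take_Suc: "s < length xs \<Longrightarrow> set (take (Suc s) xs) = insert (xs ! s) (set (take s xs))"
  by (simp add: take_Suc_conv_app_nth)

lemma card_unc_take_Suc:
  assumes "finite E" "s < length xs"
  shows "card (unc E (set (take s xs))) = card (unc E (set (take (Suc s) xs))) + gain E xs s"
  using card_unc_insert[OF assms(1)] assms(2) by (simp add: gain_def set_take_Suc)

section \<open>Correspondence between orderings, numbered from 1, and the prefixes of lists\<close>

lemma list_of_ordering:
  assumes fin: "finite V" and ord: "vertex_ordering V \<sigma>"
  shows "\<exists>xs. distinct xs \<and> set xs = V \<and> (\<forall>s. set (take s xs) = {v \<in> V. \<sigma> v \<le> s})"
proof -
  let ?g = "inv_into V \<sigma>"
  let ?xs = "map ?g [1..<Suc (card V)]"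
  have bij: "bij_betw \<sigma> V {1..card V}"
    using ord by (simp add: vertex_ordering_def)
  have bg: "bij_betw ?g {1..card V} V"
    using bij by (rule bij_betw_inv_into)
  have set_upt: "set [1..<Suc (card V)] = {1..card V}" by auto
  have d: "distinct ?xs"
    unfolding distinct_map set_upt using bg by (auto simp: bij_betw_def)
  have s: "set ?xs = V"
    unfolding set_map set_upt using bg by (simp add: bij_betw_def)
  have "set (take s ?xs) = {v \<in> V. \<sigma> v \<le> s}" for s
  proof -
    have "set (take s [1..<Suc (card V)]) = {i \<in> {1..card V}. i \<le> s}"
      by (cases "s \<le> card V") (auto simp: take_upt simp del: upt_Suc)
    hence "set (take s ?xs) = ?g ` {i \<in> {1..card V}. i \<le> s}"
      by (simp only: take_map set_map)
    also have "\<dots> = {v \<in> V. \<sigma> v \<le> s}"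
    proof (intro equalityI subsetI)
      fix v assume "v \<in> ?g ` {i \<in> {1..card V}. i \<le> s}"
      then obtain i where i: "i \<in> {1..card V}" "i \<le> s" "v = ?g i" by blast
      have "v \<in> V" using i bg by (auto simp: bij_betw_def)
      moreover have "\<sigma> v = i" using i bij by (simp add: bij_betw_inv_into_right)
      ultimately show "v \<in> {v \<in> V. \<sigma> v \<le> s}" using i by simp
    next
      fix v assume v: "v \<in> {v \<in> V. \<sigma> v \<le> s}"
      hence "\<sigma> v \<in> {1..card V}" using bij by (auto simp: bij_betw_def)
      moreover have "?g (\<sigma> v) = v" using v bij by (simp add: bij_betw_inv_into_left)
      ultimately show "v \<in> ?g ` {i \<in> {1..card V}. i \<le> s}" using v by force
    qed
    finally show ?thesis .
  qed
  thus ?thesis using d s by blast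
qed

lemma ordering_of_list:
  assumes "distinct xs"
  shows "\<exists>\<sigma>. vertex_ordering (set xs) \<sigma> \<and> (\<forall>s. set (take s xs) = {v \<in> set xs. \<sigma> v \<le> s})"
proof -
  let ?h = "inv_into {..<length xs} ((!) xs)"
  have bij: "bij_betw ((!) xs) {..<length xs} (set xs)"
    using assms by (intro bij_betw_nth) auto
  have bh: "bij_betw ?h (set xs) {..<length xs}"
    using bij by (rule bij_betw_inv_into)
  have bs: "bij_betw Suc {..<length xs} {1..card (set xs)}"
    using assms by (auto simp: bij_betw_def distinct_card image_Suc_lessThan)
  have "bij_betw (Suc \<circ> ?h) (set xs) {1..card (set xs)}"
    using bh bs by (rule bij_betw_trans)
  hence "vertex_ordering (set xs) (Suc \<circ> ?h)"
    by (simp add: vertex_ordering_def)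
  moreover have "set (take s xs) = {v \<in> set xs. (Suc \<circ> ?h) v \<le> s}" for s
  proof -
    have h: "?h (xs ! i) = i" if "i < length xs" for i
      using bij that by (simp add: bij_betw_inv_into_left)
    show ?thesis
    proof (intro equalityI subsetI)
      fix v assume "v \<in> set (take s xs)"
      then obtain i where "i < length xs" "i < s" "v = xs ! i" by (auto simp: in_set_conv_nth)
      thus "v \<in> {v \<in> set xs. (Suc \<circ> ?h) v \<le> s}" by (simp add: h)
    next
      fix v assume v: "v \<in> {v \<in> set xs. (Suc \<circ> ?h) v \<le> s}"
      then obtain i where i: "i < length xs" "v = xs ! i" by (auto simp: in_set_conv_nth)
      hence "i < s" using v by (simp add: h)
      thus "v \<in> set (take s xs)" using i by (auto simp: in_set_conv_nth)
    qed
  qed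
  ultimately show ?thesis by blast
qed

text \<open>Exchange of summation: an edge contributes 1 for each time
  \<open>s < cover_time \<sigma> e\<close>, and all of these times lie below \<open>card V\<close>,
  so none is lost.\<close>

lemma ordering_cost_eq:
  assumes "finite V" "finite E" "\<And>e. e \<in> E \<Longrightarrow> e \<subseteq> V \<and> e \<noteq> {}" "vertex_ordering V \<sigma>"
  shows "ordering_cost E \<sigma> = (\<Sum>s<card V. card (unc E {v \<in> V. \<sigma> v \<le> s}))"
proof -
  have ct: "cover_time \<sigma> e = (\<Sum>s<card V. of_bool (e \<inter> {v \<in> V. \<sigma> v \<le> s} = {}))" if "e \<in> E" for e
  proof -
    have e: "e \<subseteq> V" "e \<noteq> {}" "finite e"
      using assms that by (auto intro: finite_subset)
    have iff: "e \<inter> {v \<in> V. \<sigma> v \<le> s} = {} \<longleftrightarrow> s < cover_time \<sigma> e" for s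
      proof -
      have "s < cover_time \<sigma> e \<longleftrightarrow> (\<forall>v\<in>e. s < \<sigma> v)"
        unfolding cover_time_def using e by (subst Min_gr_iff) auto
      thus ?thesis using e(1) by (auto simp: not_le[symmetric])
    qed
    have "cover_time \<sigma> e \<in> \<sigma> ` e"
      unfolding cover_time_def using e by (intro Min_in) auto
    moreover have "\<sigma> ` e \<subseteq> {1..card V}"
      using assms(4) e(1) unfolding vertex_ordering_def bij_betw_def by blast
    ultimately have "cover_time \<sigma> e \<le> card V" by auto
    hence "{..<card V} \<inter> {s. s < cover_time \<sigma> e} = {..<cover_time \<sigma> e}" by auto
    thus ?thesis
      unfolding iff by (simp add: sum_of_bool_eq)
  qed
  have "ordering_cost E \<sigma> = (\<Sum>e\<in>E. \<Sum>s<card V. of_bool (e \<inter> {v \<in> V. \<sigma> v \<le> s} = {}))"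
    unfolding ordering_cost_def using ct by simp
  also have "\<dots> = (\<Sum>s<card V. \<Sum>e\<in>E. of_bool (e \<inter> {v \<in> V. \<sigma> v \<le> s} = {}))"
    by (rule sum.swap)
  also have "\<dots> = (\<Sum>s<card V. card (unc E {v \<in> V. \<sigma> v \<le> s}))"
    using assms(2) by (simp add: sum_of_bool_eq unc_def Int_def)
  finally show ?thesis .
qed

lemma opt_list_of_msvc:
  assumes "finite V" "finite E" "\<And>e. e \<in> E \<Longrightarrow> e \<subseteq> V \<and> e \<noteq> {}" "min_sum_vertex_cover V E \<sigma>"
  obtains xs where "opt_list V E xs" "\<And>s. set (take s xs) = {v \<in> V. \<sigma> v \<le> s}"
proof -
  have ord: "vertex_ordering V \<sigma>" using assms by (simp add: min_sum_vertex_cover_def)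
  then obtain xs where xs: "distinct xs" "set xs = V" "\<And>s. set (take s xs) = {v \<in> V. \<sigma> v \<le> s}"
    using list_of_ordering[OF assms(1)] by blast
  have "list_cost E xs \<le> list_cost E ys" if ys: "distinct ys" "set ys = V" for ys
  proof -
    obtain \<rho> where r: "vertex_ordering V \<rho>" "\<And>s. set (take s ys) = {v \<in> V. \<rho> v \<le> s}"
      using ordering_of_list[OF ys(1)] ys(2) by blast
    have l: "length xs = card V" "length ys = card V"
      using distinct_card[OF xs(1)] distinct_card[OF ys(1)] xs(2) ys(2) by simp_all
    have "ordering_cost E \<sigma> \<le> ordering_cost E \<rho>"
      using assms(4) r by (simp add: min_sum_vertex_cover_def)
    thus ?thesis
      unfolding list_cost_def l xs(3) r(2)
      using ordering_cost_eq[OF assms(1-3) ord] ordering_cost_eq[OF assms(1-3) r(1)] by simp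
  qed
  thus ?thesis using that xs unfolding opt_list_def by blast
qed

lemma msvc_exists:
  assumes "finite V"
  shows "\<exists>\<sigma>. min_sum_vertex_cover V E \<sigma>"
proof -
  obtain xs where "distinct xs" "set xs = V" using assms finite_distinct_list by blast
  then obtain \<sigma> where "vertex_ordering V \<sigma>" using ordering_of_list by blast
  thus ?thesis
    unfolding min_sum_vertex_cover_def
    using ex_has_least_nat[of "vertex_ordering V" \<sigma> "ordering_cost E"] by blast
qed

text \<open>Swapping two neighbours \<open>x\<close>, \<open>y\<close> of the list changes only the
  prefix of length \<open>Suc s\<close>. By optimality \<open>y\<close> would not cover more than
  \<open>x\<close> if it came first, and it covers even fewer edges in second place.\<close>

lemma gain_Suc_le:
  assumes fin: "finite E" and opt: "opt_list V E xs" and s: "Suc s < length xs"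
  shows "gain E xs (Suc s) \<le> gain E xs s"
proof -
  define x where "x = xs ! s"
  define y where "y = xs ! Suc s"
  define P where "P = set (take s xs)"
  define ys where "ys = xs[s := y, Suc s := x]"
  have dist: "distinct xs" and setx: "set xs = V" using opt by (auto simp: opt_list_def)
  have ys: "distinct ys" "set ys = V" "length ys = length xs"
    using dist setx s by (auto simp: ys_def x_def y_def)
  have same: "set (take n ys) = set (take n xs)" if "n \<noteq> Suc s" for n
  proof (cases "n \<le> s")
    case True thus ?thesis by (simp add: ys_def)
  next
    case False
    hence n: "Suc s < n" using that by simp
    have "take n ys = (take n xs)[s := take n xs ! Suc s, Suc s := take n xs ! s]"
      using n by (simp add: ys_def x_def y_def take_update_swap)
    moreover have "Suc s < length (take n xs)" "s < length (take n xs)" using n s by auto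
    ultimately show ?thesis by (simp only: set_swap)
  qed
  have tx: "set (take (Suc s) xs) = insert x P" using s by (simp add: set_take_Suc x_def P_def)
  have ty: "set (take (Suc s) ys) = insert y P"
    using s by (simp add: set_take_Suc ys(3)) (simp add: ys_def P_def)
  let ?u = "\<lambda>zs n. card (unc E (set (take n zs)))"
  have "list_cost E xs \<le> list_cost E ys" using opt ys by (simp add: opt_list_def)
  moreover have "list_cost E xs = ?u xs (Suc s) + (\<Sum>n\<in>{..<length xs} - {Suc s}. ?u xs n)"
    unfolding list_cost_def using s by (intro sum.remove) auto
  moreover have "list_cost E ys = ?u ys (Suc s) + (\<Sum>n\<in>{..<length xs} - {Suc s}. ?u ys n)"
    unfolding list_cost_def ys(3) using s by (intro sum.remove) auto
  moreover have "(\<Sum>n\<in>{..<length xs} - {Suc s}. ?u ys n) = (\<Sum>n\<in>{..<length xs} - {Suc s}. ?u xs n)"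
    by (intro sum.cong) (auto simp: same)
  ultimately have le: "card (unc E (insert x P)) \<le> card (unc E (insert y P))"
    using tx ty by simp
  have "gain E xs (Suc s) = card {e \<in> unc E (insert x P). y \<in> e}"
    by (simp add: gain_def tx y_def)
  also have "\<dots> \<le> card {e \<in> unc E P. y \<in> e}"
    using fin by (intro card_mono) (auto simp: unc_def)
  also have "\<dots> \<le> card {e \<in> unc E P. x \<in> e}"
    using le card_unc_insert[OF fin, of P x] card_unc_insert[OF fin, of P y] by linarith
  also have "\<dots> = gain E xs s" by (simp add: gain_def P_def x_def)
  finally show ?thesis .
qed

lemma gain_antimono:
  assumes "finite E" "opt_list V E xs" "s \<le> s'" "s' < length xs"
  shows "gain E xs s' \<le> gain E xs s"
  using assms(3,4)
proof (induction s' rule: dec_induct)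
  case (step n)
  thus ?case using gain_Suc_le[OF assms(1,2), of n] by simp
qed simp

text \<open>Deleting entries only moves the remaining ones forward. This compares prefixes of a
  modified ordering with those of the original one.\<close>

lemma set_take_filter: "set (take r zs) - X \<subseteq> set (take r (filter (\<lambda>z. z \<notin> X) zs))"
proof (induction zs arbitrary: r)
  case (Cons z zs)
  show ?case
  proof (cases r)
    case (Suc r')
    have "set (take r' zs) - X \<subseteq> set (take r' (filter (\<lambda>z. z \<notin> X) zs))" by (rule Cons.IH)
    moreover have "set (take r' ws) \<subseteq> set (take (Suc r') ws)" for ws :: "'a list"
      by (rule set_take_subset_set_take) simp
    ultimately show ?thesis using Suc by auto
  qed simp
qed simp

text \<open>Double counting of the pairs \<open>(a, w)\<close> with \<open>a \<in> D\<close> and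
  \<open>w \<in> S a \<inter> W\<close>. The upper bound is asked only for \<open>w\<close> in some
  \<open>S a\<close>, since in the applications this \<open>a\<close> names the block in which
  \<open>w\<close> lies.\<close>

lemma double_count_le:
  assumes "finite D" "finite W" and lower: "\<And>a. a \<in> D \<Longrightarrow> m \<le> card (S a \<inter> W)"
    and upper: "\<And>a w. a \<in> D \<Longrightarrow> w \<in> S a \<Longrightarrow> card {a' \<in> D. w \<in> S a'} \<le> n"
  shows "card D * m \<le> card W * n"
proof -
  have "card D * m \<le> (\<Sum>a\<in>D. card (S a \<inter> W))"
    using sum_bounded_below[of D m] lower by simp
  also have "\<dots> = (\<Sum>a\<in>D. \<Sum>w\<in>W. of_bool (w \<in> S a))"
    using assms(2) by (simp add: sum_of_bool_eq Int_commute)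
  also have "\<dots> = (\<Sum>w\<in>W. \<Sum>a\<in>D. of_bool (w \<in> S a))" by (rule sum.swap)
  also have "\<dots> = (\<Sum>w\<in>W. card {a \<in> D. w \<in> S a})"
    using assms(1) by (simp add: sum_of_bool_eq Int_def)
  also have "\<dots> \<le> card W * n"
  proof -
    have "card {a \<in> D. w \<in> S a} \<le> n" for w
    proof (cases "{a \<in> D. w \<in> S a} = {}")
      case False
      thus ?thesis using upper by blast
    qed (simp only: card.empty)
    thus ?thesis using sum_bounded_above[of W "\<lambda>w. card {a \<in> D. w \<in> S a}" n] by simp
  qed
  finally show ?thesis .
qed

section \<open>The block graph\<close>

text \<open>At level \<open>j\<close> two blocks face each other when they carry the same label
  \<open>blk j\<close>. The inequality \<open>q_ge\<close> is calibrated for the union over all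
  levels in \<open>card_full_ge\<close>.\<close>

locale block_graph =
  fixes A :: "'a set" and B :: "nat \<Rightarrow> 'a set" and blk :: "nat \<Rightarrow> 'a \<Rightarrow> nat" and q t :: nat
  assumes finite_A: "finite A" and finite_B: "\<And>j. finite (B j)"
    and disj_AB: "\<And>j. A \<inter> B j = {}" and disj_BB: "\<And>i j. i \<noteq> j \<Longrightarrow> B i \<inter> B j = {}"
    and card_A: "card A = 32 * q ^ t" and card_B: "\<And>j. card (B j) = q ^ t"
    and card_blk_A: "\<And>j a. j < t \<Longrightarrow> a \<in> A \<Longrightarrow> card {a' \<in> A. blk j a' = blk j a} = 32 * q ^ j"
    and card_blk_B: "\<And>j a. j < t \<Longrightarrow> a \<in> A \<Longrightarrow> card {b \<in> B j. blk j b = blk j a} = q ^ j"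
    and nested: "\<And>i j a a'. i \<le> j \<Longrightarrow> j < t \<Longrightarrow> a \<in> A \<Longrightarrow> a' \<in> A \<Longrightarrow>
                  blk i a = blk i a' \<Longrightarrow> blk j a = blk j a'"
    and t_pos: "0 < t" and q_ge: "t * (32 + t) \<le> 4 * q"
begin

definition V :: "'a set" where "V = A \<union> (\<Union>j<t. B j)"

definition E :: "'a set set" where
  "E = {{a, b} | a b j. j < t \<and> a \<in> A \<and> b \<in> B j \<and> blk j a = blk j b}"

definition Ab :: "nat \<Rightarrow> 'a \<Rightarrow> 'a set" where "Ab j a = {a' \<in> A. blk j a' = blk j a}"
definition Bb :: "nat \<Rightarrow> 'a \<Rightarrow> 'a set" where "Bb j a = {b \<in> B j. blk j b = blk j a}"

definition low :: "nat \<Rightarrow> nat" where "low j = (\<Sum>i<j. q ^ i)"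

lemma q_ge_2: "2 \<le> q"
proof -
  have "1 * (32 + 1) \<le> t * (32 + t)" using t_pos by (intro mult_mono) auto
  hence "1 * (32 + 1) \<le> 4 * q" using q_ge by (rule order_trans)
  thus ?thesis by simp
qed

lemma low_Suc_le: "low (Suc j) \<le> 2 * q ^ j"
proof (induction j)
  case (Suc j)
  have "low (Suc (Suc j)) = low (Suc j) + q ^ Suc j" by (simp add: low_def)
  also have "\<dots> \<le> 2 * q ^ j + q ^ Suc j" using Suc by simp
  also have "\<dots> \<le> q * q ^ j + q ^ Suc j" using q_ge_2 by (intro add_mono mult_mono) auto
  finally show ?case by simp
qed (simp add: low_def)

text \<open>The source of the factor \<open>1/q\<close>: a postponed vertex of \<open>A\<close>
  risks \<open>low j\<close> edges, while moving a vertex of \<open>B j\<close> forward wins a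
  multiple of \<open>q ^ j\<close>.\<close>

lemma q_low_le: "q * low j \<le> 2 * q ^ j"
proof (cases j)
  case (Suc i)
  have "q * low (Suc i) \<le> q * (2 * q ^ i)" using low_Suc_le by (intro mult_le_mono2)
  thus ?thesis using Suc by simp
qed (simp add: low_def)

lemma finite_V: "finite V" by (simp add: V_def finite_A finite_B)

lemma edge_in_V: "e \<in> E \<Longrightarrow> e \<subseteq> V \<and> e \<noteq> {}"
  by (auto simp: E_def V_def)

lemma finite_E: "finite E"
proof (rule finite_subset)
  show "E \<subseteq> Pow V" using edge_in_V by blast
qed (simp add: finite_V)

lemma card_V: "card V = (32 + t) * q ^ t"
proof -
  have "card (\<Union>j<t. B j) = (\<Sum>j<t. card (B j))"
    using finite_B disj_BB by (intro card_UN_disjoint) auto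
  hence "card (\<Union>j<t. B j) = t * q ^ t" by (simp add: card_B)
  moreover have "card V = card A + card (\<Union>j<t. B j)"
    unfolding V_def using disj_AB finite_A finite_B by (intro card_Un_disjoint) auto
  ultimately show ?thesis by (simp add: card_A algebra_simps)
qed

lemma bipartite: "bipartite_graph V E"
proof -
  have "card e = 2" if "e \<in> E" for e
  proof -
    obtain a b j where "e = {a, b}" "a \<in> A" "b \<in> B j" using \<open>e \<in> E\<close> by (auto simp: E_def)
    thus ?thesis using disj_AB[of j] by (auto simp: card_insert_if)
  qed
  hence "finite_graph V E" using finite_V edge_in_V by (auto simp: finite_graph_def)
  moreover have "A \<inter> (\<Union>j<t. B j) = {}" using disj_AB by blast
  moreover have "\<forall>e\<in>E. \<exists>a\<in>A. \<exists>b\<in>(\<Union>j<t. B j). e = {a, b}" by (auto simp: E_def)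
  ultimately show ?thesis unfolding bipartite_graph_def V_def by blast
qed

text \<open>At level 0 every block is a star with 32 leaves, so a cover contains a vertex with each
  of the \<open>q ^ t\<close> labels. Vertices of a cover outside level 0 also have some value of
  \<open>blk 0\<close>, which can only enlarge the image.\<close>

lemma vc_number_bounds: "q ^ t \<le> vc_number V E" "vc_number V E \<le> 32 * q ^ t"
proof -
  let ?C = "{card S | S. vertex_cover V E S}"
  have "?C \<subseteq> {..card V}" using finite_V by (auto simp: vertex_cover_def intro: card_mono)
  hence fin: "finite ?C" using finite_subset by blast
  have "vertex_cover V E A" by (auto simp: vertex_cover_def V_def E_def)
  hence A: "card A \<in> ?C" by blast
  show "vc_number V E \<le> 32 * q ^ t"
    unfolding vc_number_def using Min_le[OF fin A] by (simp add: card_A)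
  have "q ^ t \<le> card S" if S: "vertex_cover V E S" for S
  proof -
    have finS: "finite S" using S finite_V finite_subset by (auto simp: vertex_cover_def)
    have sub: "blk 0 ` A \<subseteq> blk 0 ` S"
    proof
      fix c assume "c \<in> blk 0 ` A"
      then obtain a where a: "a \<in> A" "c = blk 0 a" by blast
      have "card {b \<in> B 0. blk 0 b = blk 0 a} = 1" using card_blk_B[of 0 a] a t_pos by simp
      hence "{b \<in> B 0. blk 0 b = blk 0 a} \<noteq> {}" by (metis card.empty zero_neq_one)
      then obtain b where "b \<in> B 0" "blk 0 b = blk 0 a" by blast
      hence "{a, b} \<in> E" using a t_pos by (force simp: E_def)
      hence "{a, b} \<inter> S \<noteq> {}" using S unfolding vertex_cover_def by blast
      hence "a \<in> S \<or> b \<in> S" by blast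
      thus "c \<in> blk 0 ` S" using a \<open>blk 0 b = blk 0 a\<close> by (metis imageI)
    qed
    have "card A = (\<Sum>c\<in>blk 0 ` A. card {a \<in> A. blk 0 a = c})"
      using sum.image_gen[OF finite_A, of "\<lambda>_. 1::nat" "blk 0"] by simp
    also have "\<dots> = (\<Sum>c\<in>blk 0 ` A. 32)"
      using card_blk_A[of 0] t_pos by (intro sum.cong) auto
    finally have "q ^ t = card (blk 0 ` A)" by (simp add: card_A)
    also have "\<dots> \<le> card (blk 0 ` S)" using sub finS by (intro card_mono) auto
    also have "\<dots> \<le> card S" using finS by (rule card_image_le)
    finally show ?thesis .
  qed
  thus "q ^ t \<le> vc_number V E"
    unfolding vc_number_def using fin A by (subst Min_ge_iff) auto
qed

section \<open>Residual degrees and the exchange estimate\<close>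

lemma finite_Ab: "finite (Ab j a)" by (simp add: Ab_def finite_A)

lemma finite_Bb: "finite (Bb j a)" by (simp add: Bb_def finite_B)

lemma residual_degree_A:
  assumes a: "a \<in> A" and cov: "\<And>i. j \<le> i \<Longrightarrow> i < t \<Longrightarrow> Bb i a \<subseteq> P" and j: "j \<le> t"
  shows "card {e \<in> unc E P. a \<in> e} \<le> low j"
proof -
  have "{e \<in> unc E P. a \<in> e} \<subseteq> (\<Union>i<j. (\<lambda>b. {a, b}) ` Bb i a)"
  proof
    fix e assume "e \<in> {e \<in> unc E P. a \<in> e}"
    hence e: "e \<in> E" "e \<inter> P = {}" "a \<in> e" by (auto simp: unc_def)
    then obtain a' b i where ab: "e = {a', b}" "i < t" "a' \<in> A" "b \<in> B i" "blk i a' = blk i b"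
      by (auto simp: E_def)
    have "a' = a" using e ab a disj_AB[of i] by auto
    hence b: "b \<in> Bb i a" using ab by (simp add: Bb_def)
    have "i < j" using cov[of i] b ab(1,2) e(2) by (cases "j \<le> i") auto
    thus "e \<in> (\<Union>i<j. (\<lambda>b. {a, b}) ` Bb i a)" using b ab(1) \<open>a' = a\<close> by blast
  qed
  hence "card {e \<in> unc E P. a \<in> e} \<le> card (\<Union>i<j. (\<lambda>b. {a, b}) ` Bb i a)"
    by (intro card_mono) (auto simp: finite_Bb)
  also have "\<dots> \<le> (\<Sum>i<j. card ((\<lambda>b. {a, b}) ` Bb i a))"
    by (intro card_UN_le) simp
  also have "\<dots> \<le> (\<Sum>i<j. q ^ i)"
  proof (intro sum_mono)
    fix i assume "i \<in> {..<j}"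
    thus "card ((\<lambda>b. {a, b}) ` Bb i a) \<le> q ^ i"
      using card_image_le[OF finite_Bb, of "\<lambda>b. {a, b}" i a] card_blk_B[of i a] a j
      by (simp add: Bb_def)
  qed
  finally show ?thesis by (simp add: low_def)
qed

lemma residual_degree_B:
  assumes "j < t" "b \<in> Bb j a"
  shows "card (Ab j a - P) \<le> card {e \<in> unc E P. b \<in> e} \<or> b \<in> P"
proof (cases "b \<in> P")
  case False
  have "(\<lambda>x. {x, b}) ` (Ab j a - P) \<subseteq> {e \<in> unc E P. b \<in> e}"
    using assms False by (force simp: unc_def E_def Ab_def Bb_def)
  moreover have "inj_on (\<lambda>x. {x, b}) (Ab j a - P)" by (auto simp: inj_on_def doubleton_eq_iff)
  moreover have "finite {e \<in> unc E P. b \<in> e}" using finite_E by simp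
  ultimately show ?thesis using card_inj_on_le by blast
qed simp

text \<open>Adding \<open>R\<close> covers all edges between \<open>R\<close> and the unused part of its \<open>A\<close>-block; dropping \<open>X\<close>
  only uncovers edges of levels below \<open>j\<close>.\<close>

lemma exchange_uncovered:
  assumes a: "a \<in> A" and j: "j < t"
    and cov: "\<And>i. j < i \<Longrightarrow> i < t \<Longrightarrow> Bb i a \<subseteq> P"
    and R: "R \<subseteq> Bb j a" "Bb j a \<subseteq> P \<union> R" "R \<inter> P = {}" and X: "X \<subseteq> Ab j a"
  shows "card (unc E ((P \<union> R) - X)) + card R * card (Ab j a - P)
           \<le> card (unc E P) + card X * low j"
proof -
  let ?P' = "(P \<union> R) - X"
  let ?K = "(\<lambda>(x, b). {x, b}) ` ((Ab j a - P) \<times> R)"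
  let ?L = "\<Union>x\<in>X. {e \<in> unc E ?P'. x \<in> e}"
  have finX: "finite X" and finR: "finite R" using X R finite_Ab finite_Bb finite_subset by blast+
  have RB: "R \<subseteq> B j" and AA: "Ab j a \<subseteq> A" using R by (auto simp: Bb_def Ab_def)
  have K: "?K \<subseteq> unc E P"
    using R j by (force simp: unc_def E_def Ab_def Bb_def)
  have "inj_on (\<lambda>(x, b). {x, b}) ((Ab j a - P) \<times> R)"
    using RB AA disj_AB[of j] by (auto simp: inj_on_def doubleton_eq_iff)
  hence cK: "card ?K = card R * card (Ab j a - P)"
    by (simp add: card_image card_cartesian_product mult.commute)
  have sub: "unc E ?P' \<subseteq> (unc E P - ?K) \<union> ?L"
    by (auto simp: unc_def)
  have cL: "card ?L \<le> card X * low j"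
  proof -
    have "card {e \<in> unc E ?P'. x \<in> e} \<le> low j" if x: "x \<in> X" for x
    proof (rule residual_degree_A)
      show "x \<in> A" using x X AA by blast
      show "Bb i x \<subseteq> ?P'" if i: "j \<le> i" "i < t" for i
      proof -
        have "blk j x = blk j a" using x X by (auto simp: Ab_def)
        hence "blk i x = blk i a" using nested[OF i] \<open>x \<in> A\<close> a by blast
        hence "Bb i x = Bb i a" by (simp add: Bb_def)
        moreover have "Bb i a \<subseteq> P \<union> R" using cov[of i] R(2) i by (cases "i = j") auto
        moreover have "Bb i a \<inter> X = {}" using X AA disj_AB[of i] by (auto simp: Bb_def)
        ultimately show ?thesis by blast
      qed
    qed (use j in simp)
    hence "(\<Sum>x\<in>X. card {e \<in> unc E ?P'. x \<in> e}) \<le> card X * low j"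
      using sum_bounded_above[of X "\<lambda>x. card {e \<in> unc E ?P'. x \<in> e}" "low j"] by simp
    thus ?thesis using card_UN_le[OF finX, of "\<lambda>x. {e \<in> unc E ?P'. x \<in> e}"] by linarith
  qed
  have "card (unc E ?P') \<le> card ((unc E P - ?K) \<union> ?L)"
    using sub finite_E finX by (intro card_mono) auto
  also have "\<dots> \<le> card (unc E P - ?K) + card ?L" by (rule card_Un_le)
  also have "card (unc E P - ?K) = card (unc E P) - card ?K"
    using K finite_subset[OF K finite_unc[OF finite_E]] by (intro card_Diff_subset)
  finally show ?thesis
    using cK cL card_mono[OF finite_unc[OF finite_E] K] by linarith
qed

end

section \<open>Optimal orderings of the block graph\<close>

locale optimal_block_graph = block_graph +
  fixes xs :: "'a list"
  assumes opt: "opt_list V E xs"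
begin

abbreviation pre :: "nat \<Rightarrow> 'a set" where "pre s \<equiv> set (take s xs)"

text \<open>The disjunct \<open>length xs \<le> s\<close> keeps \<open>LEAST\<close> from ranging over an empty predicate.\<close>

definition cut :: "nat \<Rightarrow> nat" where
  "cut j = (LEAST s. length xs \<le> s \<or> gain E xs s < 16 * q ^ j)"

text \<open>The schedule: the block facing \<open>a\<close> at level \<open>i\<close> is exhausted
  by the end of phase \<open>i\<close>, for all levels from the top down to \<open>j\<close>. For
  \<open>j = t\<close> this is vacuous, where the descent starts.\<close>

definition full :: "nat \<Rightarrow> 'a \<Rightarrow> bool" where
  "full j a \<longleftrightarrow> (\<forall>i. j \<le> i \<longrightarrow> i < t \<longrightarrow> Bb i a \<subseteq> pre (cut i))"

section \<open>Phases and vertices on schedule\<close>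

lemma dist: "distinct xs" and set_xs: "set xs = V"
  using opt by (auto simp: opt_list_def)

lemma length_xs: "length xs = (32 + t) * q ^ t"
  using distinct_card[OF dist] set_xs card_V by simp

lemma pre_mono: "s \<le> s' \<Longrightarrow> pre s \<subseteq> pre s'"
  by (rule set_take_subset_set_take)

lemma le_of_nth_notin_pre: "p < length xs \<Longrightarrow> xs ! p \<notin> pre s \<Longrightarrow> s \<le> p"
  by (metis in_set_conv_nth length_take min_less_iff_conj not_le nth_take)

lemma cut_prop: "length xs \<le> cut j \<or> gain E xs (cut j) < 16 * q ^ j"
  unfolding cut_def by (rule LeastI[of _ "length xs"]) simp

lemma cut_le: "cut j \<le> length xs"
  unfolding cut_def by (rule Least_le) simp

lemma gain_before_cut: "s < cut j \<Longrightarrow> 16 * q ^ j \<le> gain E xs s"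
  unfolding cut_def by (auto dest: not_less_Least)

lemma gain_after_cut: "cut j \<le> s \<Longrightarrow> s < length xs \<Longrightarrow> gain E xs s < 16 * q ^ j"
  using cut_prop[of j] gain_antimono[OF finite_E opt, of "cut j" s] by linarith

lemma cut_antimono:
  assumes "i \<le> j" shows "cut j \<le> cut i"
proof (rule ccontr)
  assume "\<not> cut j \<le> cut i"
  hence lt: "cut i < cut j" by simp
  hence "16 * q ^ j \<le> gain E xs (cut i)" by (rule gain_before_cut)
  moreover have "gain E xs (cut i) < 16 * q ^ i" using cut_prop[of i] lt cut_le[of j] by linarith
  moreover have "q ^ i \<le> q ^ j" using assms q_ge_2 by (intro power_increasing) auto
  ultimately show False by linarith
qed

lemma full_mono: "i \<le> j \<Longrightarrow> full i a \<Longrightarrow> full j a"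
  by (auto simp: full_def)

lemma full_nested:
  assumes "full (Suc j) a" "j < t" "a \<in> A" "x \<in> Ab j a"
  shows "full (Suc j) x"
proof -
  have "Bb i x = Bb i a" if "Suc j \<le> i" "i < t" for i
    using nested[of j i x a] assms that by (auto simp: Bb_def Ab_def)
  thus ?thesis using assms(1) by (auto simp: full_def)
qed

text \<open>Induction from the top level down. If \<open>a\<close> were chosen at a time
  \<open>s < cut j\<close>, the induction hypothesis puts \<open>s\<close> after
  \<open>cut i\<close> for all \<open>i > j\<close>, so the blocks facing \<open>a\<close> at these
  levels are exhausted. Its gain is then at most \<open>low (Suc j)\<close>, too small for a time
  before \<open>cut j\<close>.\<close>

lemma full_not_in_pre:
  assumes "j < t" "a \<in> A" "full (Suc j) a"
  shows "a \<notin> pre (cut j)"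
  using assms
proof (induction "t - j" arbitrary: j rule: less_induct)
  case less
  show ?case
  proof
    assume "a \<in> pre (cut j)"
    then obtain s where s: "s < cut j" "s < length xs" "xs ! s = a"
      by (auto simp: in_set_conv_nth)
    have "Bb i a \<subseteq> pre s" if i: "Suc j \<le> i" "i < t" for i
    proof -
      have "a \<notin> pre (cut i)"
        using less i full_mono[of "Suc j" "Suc i" a] by simp
      hence "cut i \<le> s" using s le_of_nth_notin_pre by blast
      thus ?thesis using less.prems(3) i pre_mono[of "cut i" s] by (auto simp: full_def)
    qed
    hence "gain E xs s \<le> low (Suc j)"
      unfolding gain_def s(3) using less.prems by (intro residual_degree_A) auto
    also have "\<dots> \<le> 2 * q ^ j" by (rule low_Suc_le)
    also have "\<dots> < 16 * q ^ j" using q_ge_2 by simp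
    finally show False using gain_before_cut[OF s(1)] by simp
  qed
qed

section \<open>The window of a block that misses the schedule\<close>

lemma card_unc_pre_le:
  assumes "s \<le> s'" "s' \<le> length xs" "cut j \<le> s"
  shows "card (unc E (pre s)) \<le> card (unc E (pre s')) + (s' - s) * (16 * q ^ j)"
  using assms(1,2)
proof (induction s' rule: dec_induct)
  case (step n)
  have "card (unc E (pre n)) = card (unc E (pre (Suc n))) + gain E xs n"
    using step by (intro card_unc_take_Suc finite_E) simp
  moreover have "gain E xs n < 16 * q ^ j" using step assms(3) by (intro gain_after_cut) auto
  moreover have "Suc n - s = Suc (n - s)" using step by simp
  ultimately show ?case using step by simp
qed simp

lemma deficient_window:
  assumes j: "j < t" and a: "a \<in> A" and full: "full (Suc j) a"
    and R_def: "R = Bb j a - pre (cut j)" and ne: "R \<noteq> {}"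
  obtains T where "cut j \<le> T" "T \<le> length xs" "card (Ab j a \<inter> pre T) = 8 * q ^ j"
    "R \<inter> pre T = {}" "Ab j a \<inter> pre (cut j) = {}"
proof -
  define f where "f s = card (Ab j a \<inter> pre s)" for s
  have cA: "card (Ab j a) = 32 * q ^ j" using card_blk_A[OF j a] by (simp add: Ab_def)
  have q0: "0 < q ^ j" using q_ge_2 by simp
  have f_mono: "f s \<le> f s'" if "s \<le> s'" for s s'
    unfolding f_def using pre_mono[OF that] finite_Ab by (intro card_mono) auto
  have f_Suc: "f (Suc s) \<le> Suc (f s)" for s
  proof (cases "s < length xs")
    case True
    hence "Ab j a \<inter> pre (Suc s) \<subseteq> insert (xs ! s) (Ab j a \<inter> pre s)" by (auto simp: set_take_Suc)
    hence "f (Suc s) \<le> card (insert (xs ! s) (Ab j a \<inter> pre s))"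
      unfolding f_def by (intro card_mono) auto
    also have "\<dots> \<le> Suc (f s)" by (simp add: f_def card_insert_le_m1 card_insert_if)
    finally show ?thesis .
  qed (simp add: f_def)
  have "Ab j a \<inter> pre (length xs) = Ab j a" using set_xs by (auto simp: Ab_def V_def)
  hence fN: "8 * q ^ j \<le> f (length xs)" using cA by (simp add: f_def)
  define T where "T = (LEAST s. 8 * q ^ j \<le> f s)"
  have T: "8 * q ^ j \<le> f T" unfolding T_def using fN by (rule LeastI)
  have T_le: "T \<le> s" if "8 * q ^ j \<le> f s" for s unfolding T_def using that by (rule Least_le)
  have disj: "Ab j a \<inter> pre (cut j) = {}"
  proof -
    have "x \<notin> pre (cut j)" if x: "x \<in> Ab j a" for x
      using full_not_in_pre[OF j, of x] full_nested[OF full j a x] x by (simp add: Ab_def)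
    thus ?thesis by blast
  qed
  have cut: "cut j \<le> T"
  proof (rule ccontr)
    assume "\<not> cut j \<le> T"
    hence "f T \<le> f (cut j)" by (intro f_mono) simp
    thus False using T disj q0 by (simp add: f_def)
  qed
  have "T \<noteq> 0" using T q0 by (auto simp: f_def intro!: Nat.gr0I)
  then obtain T' where T': "T = Suc T'" using not0_implies_Suc by blast
  have "f T' < 8 * q ^ j" using T_le[of T'] T' by (cases "8 * q ^ j \<le> f T'") auto
  hence fT: "f T = 8 * q ^ j" using f_Suc[of T'] T T' by simp
  have "R \<inter> pre T = {}"
  proof (rule ccontr)
    assume "R \<inter> pre T \<noteq> {}"
    then obtain b where "b \<in> R" "b \<in> pre T" by blast
    then obtain p where b: "b \<in> R" "p < T" "p < length xs" "b = xs ! p"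
      by (auto simp: in_set_conv_nth)
    have "cut j \<le> p" using b R_def le_of_nth_notin_pre by blast
    hence g: "gain E xs p < 16 * q ^ j" using b by (intro gain_after_cut) auto
    have "b \<notin> pre p" using b dist by (auto simp: in_set_conv_nth nth_eq_iff_index_eq)
    hence "card (Ab j a - pre p) \<le> gain E xs p"
      using residual_degree_B[OF j, of b a "pre p"] b R_def by (auto simp: gain_def)
    moreover have "card (Ab j a - pre p) = 32 * q ^ j - f p"
      using cA by (simp add: f_def card_Diff_subset_Int finite_Ab)
    ultimately have "16 * q ^ j < f p" using g q0 by linarith
    hence "T \<le> p" using q0 by (intro T_le) linarith
    thus False using b by simp
  qed
  thus ?thesis using that cut T_le[OF fN] fT disj by (simp add: f_def)
qed

text \<open>In a long window it would pay to use \<open>R\<close> first: per vertex of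
  \<open>R\<close> this wins order \<open>q ^ j\<close> at each time of the window, against a loss
  of \<open>low j\<close> at each time of the ordering.\<close>

lemma window_short:
  assumes j: "j < t" and a: "a \<in> A" and full: "full (Suc j) a"
    and R_def: "R = Bb j a - pre (cut j)" and ne: "R \<noteq> {}"
    and T: "cut j \<le> T" "T \<le> length xs" "card (Ab j a \<inter> pre T) = 8 * q ^ j"
    "R \<inter> pre T = {}" "Ab j a \<inter> pre (cut j) = {}"
  shows "q * (T - cut j) \<le> length xs"
proof -
  define c where "c = cut j"
  define \<delta> where "\<delta> = card R"
  define N where "N = length xs"
  have cA: "card (Ab j a) = 32 * q ^ j" using card_blk_A[OF j a] by (simp add: Ab_def)
  have finR: "finite R" using R_def finite_Bb by simp
  have \<delta>: "0 < \<delta>" "\<delta> \<le> q ^ j"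
  proof -
    show "0 < \<delta>" using finR ne by (simp add: \<delta>_def card_gt_0_iff)
    have "\<delta> \<le> card (Bb j a)" unfolding \<delta>_def R_def using finite_Bb by (intro card_mono) auto
    thus "\<delta> \<le> q ^ j" using card_blk_B[OF j a] by (simp add: Bb_def)
  qed
  \<comment> \<open>Taking as many vertices out of the window as are put into it keeps the two
    orderings aligned from time \<open>T\<close> on.\<close>
  have "\<delta> \<le> card (Ab j a \<inter> pre T)" using \<delta>(2) T(3) by linarith
  then obtain X where X: "X \<subseteq> Ab j a \<inter> pre T" "card X = \<delta>" and finX: "finite X"
    by (rule obtain_subset_with_card_n)
  define ys where "ys = take c xs"
  define zs where "zs = drop c (take T xs)"
  define ws where "ws = drop T xs"
  have takeT: "take T xs = ys @ zs"
  proof -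
    have ys: "ys = take c (take T xs)" using T(1) by (simp add: ys_def c_def min_absorb1)
    show ?thesis unfolding zs_def ys by (rule append_take_drop_id[symmetric])
  qed
  hence preT: "pre T = set ys \<union> set zs" by simp
  have xs: "xs = ys @ zs @ ws"
    using append_take_drop_id[of T xs, symmetric] unfolding takeT ws_def[symmetric]
    by (simp only: append_assoc)
  have len: "length ys = c" "length zs = T - c" "length ws = N - T"
    using T by (auto simp: ys_def zs_def ws_def c_def N_def)
  have prec: "pre c = set ys" by (simp add: ys_def)
  have dd: "distinct ys" "distinct zs" "distinct ws" "set ys \<inter> set zs = {}" "set ys \<inter> set ws = {}"
    "set zs \<inter> set ws = {}"
    using dist unfolding xs by auto
  have Xzs: "X \<subseteq> set zs" using X(1) T(5) preT prec by (auto simp: c_def)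
  have Rws: "R \<subseteq> set ws"
  proof -
    have "R \<subseteq> set xs" using R_def j by (auto simp: set_xs V_def Bb_def)
    thus ?thesis using T(4) preT unfolding xs by auto
  qed
  obtain rs xl where rs: "set rs = R" "distinct rs" and xl: "set xl = X" "distinct xl"
    using finite_distinct_list[OF finR] finite_distinct_list[OF finX] by blast
  have lrs: "length rs = \<delta>" using distinct_card[OF rs(2)] rs(1) by (simp add: \<delta>_def)
  txt \<open>Compared with \<open>xs\<close>, this ordering loses at most \<open>16 q^j\<close> per vertex of \<open>R\<close> while \<open>R\<close> is
    inserted, wins \<open>(24 - 16) q^j\<close> per vertex of \<open>R\<close> in the rest of the window, and loses at
    most \<open>low j\<close> per vertex of \<open>X\<close> at all later times.\<close>
  define alt where "alt = ys @ rs @ filter (\<lambda>z. z \<notin> X) zs @ filter (\<lambda>z. z \<notin> R) ws @ xl"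
  have alt: "distinct alt" "set alt = V"
  proof -
    show "distinct alt"
      unfolding alt_def using dd rs xl Xzs Rws by auto
    show "set alt = V"
      unfolding set_xs[symmetric] xs alt_def using rs(1) xl(1) Xzs Rws by auto
  qed
  have lalt: "length alt = N"
    using distinct_card[OF alt(1)] distinct_card[OF dist] alt(2) set_xs by (simp add: N_def)
  have lz: "length (filter (\<lambda>z. z \<notin> X) zs) = T - c - \<delta>"
  proof -
    have "length (filter (\<lambda>z. z \<notin> X) zs) = card (set zs - X)"
      using distinct_card[of "filter (\<lambda>z. z \<notin> X) zs"] dd(2) by (simp add: set_diff_eq)
    thus ?thesis using Xzs X(2) finX distinct_card[OF dd(2)] len by (simp add: card_Diff_subset)
  qed
  have Tc: "8 * q ^ j \<le> T - c"
  proof -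
    have "Ab j a \<inter> pre T \<subseteq> set zs" using T(5) preT prec by (auto simp: c_def)
    hence "card (Ab j a \<inter> pre T) \<le> card (set zs)" by (intro card_mono) auto
    thus ?thesis using T(3) distinct_card[OF dd(2)] len by simp
  qed
  let ?u = "\<lambda>P. card (unc E P)"
  let ?L = "\<delta> * low j"
  \<comment> \<open>The product uses \<open>R - pre s\<close> because after \<open>T\<close> the
    ordering may already have reached vertices of \<open>R\<close>; the win may then vanish, but the
    bound on the loss remains.\<close>
  have exch: "?u ((pre s \<union> R) - X) + card (R - pre s) * card (Ab j a - pre s) \<le> ?u (pre s) + ?L"
    if s: "c \<le> s" for s
  proof -
    have "?u ((pre s \<union> (R - pre s)) - X) + card (R - pre s) * card (Ab j a - pre s)
        \<le> ?u (pre s) + card X * low j"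
    proof (rule exchange_uncovered[OF a j])
      show "Bb i a \<subseteq> pre s" if i: "j < i" "i < t" for i
      proof -
        have "cut i \<le> s" using cut_antimono[of j i] i s by (simp add: c_def)
        hence "pre (cut i) \<subseteq> pre s" by (rule pre_mono)
        moreover have "Bb i a \<subseteq> pre (cut i)" using full i by (simp add: full_def)
        ultimately show ?thesis by (rule order_trans[rotated])
      qed
      show "Bb j a \<subseteq> pre s \<union> (R - pre s)" using R_def pre_mono[OF s(1)] by (auto simp: c_def)
      show "R - pre s \<subseteq> Bb j a" using R_def by blast
      show "(R - pre s) \<inter> pre s = {}" by blast
      show "X \<subseteq> Ab j a" using X(1) by blast
    qed
    thus ?thesis by (simp only: X(2) Un_Diff_cancel)
  qed
  have step: "?u (set (take s alt)) + (if c + \<delta> \<le> s \<and> s < T then 8 * q ^ j * \<delta> else 0)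
      \<le> ?u (pre s) + ?L + (if c \<le> s \<and> s < c + \<delta> then 16 * q ^ j * \<delta> else 0)"
    if "s < N" for s
  proof -
    consider "s < c" | "c \<le> s" "s < c + \<delta>" | "c + \<delta> \<le> s" "s < T" | "T \<le> s" by linarith
    thus ?thesis
    proof cases
      case 1
      have "take s alt = take s ys" "take s xs = take s ys"
        using 1 len(1) by (simp_all add: alt_def xs)
      thus ?thesis using 1 by simp
    next
      case 2
      \<comment> \<open>While \<open>R\<close> is inserted, \<open>alt\<close> is credited only with
        the state at time \<open>c\<close>. Since then \<open>xs\<close> has made fewer than
        \<open>\<delta>\<close> steps, each covering fewer than \<open>16 * q ^ j\<close>
        edges.\<close>
      have "pre c \<subseteq> set (take s alt)" using 2 len(1) by (simp add: alt_def prec)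
      hence "?u (set (take s alt)) \<le> ?u (pre c)" by (rule card_unc_antimono[OF finite_E])
      also have "\<dots> \<le> ?u (pre s) + (s - c) * (16 * q ^ j)"
        using 2 that by (intro card_unc_pre_le) (auto simp: c_def N_def)
      also have "(s - c) * (16 * q ^ j) \<le> \<delta> * (16 * q ^ j)"
        using 2 by (intro mult_le_mono1) linarith
      finally show ?thesis using 2 by (simp add: mult.commute)
    next
      case 3
      define r where "r = s - \<delta> - c"
      have s: "s = c + \<delta> + r" "r \<le> T - c - \<delta>" using 3 by (simp_all add: r_def)
      have P: "pre (c + r) = set ys \<union> set (take r zs)"
        using len s by (simp add: xs)
      have "take s alt = ys @ rs @ take r (filter (\<lambda>z. z \<notin> X) zs)"
        using s len lrs lz by (simp add: alt_def)
      hence "(pre (c + r) \<union> R) - X \<subseteq> set (take s alt)"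
        using set_take_filter[of r zs X] P rs(1) by auto
      hence "?u (set (take s alt)) \<le> ?u ((pre (c + r) \<union> R) - X)"
        by (rule card_unc_antimono[OF finite_E])
      moreover have "?u ((pre (c + r) \<union> R) - X) + \<delta> * card (Ab j a - pre (c + r)) \<le> ?u (pre (c + r)) + ?L"
      proof -
        have "R - pre (c + r) = R" using T(4) pre_mono[of "c + r" T] s 3 by auto
        thus ?thesis using exch[of "c + r"] by (simp add: \<delta>_def)
      qed
      moreover have "\<delta> * (24 * q ^ j) \<le> \<delta> * card (Ab j a - pre (c + r))"
      proof (rule mult_le_mono2)
        have "card (Ab j a \<inter> pre (c + r)) \<le> card (Ab j a \<inter> pre T)"
          using pre_mono[of "c + r" T] s 3 finite_Ab by (intro card_mono) auto
        thus "24 * q ^ j \<le> card (Ab j a - pre (c + r))"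
          using T(3) cA by (simp add: card_Diff_subset_Int finite_Ab)
      qed
      moreover have "?u (pre (c + r)) \<le> ?u (pre s) + (s - (c + r)) * (16 * q ^ j)"
        using s that by (intro card_unc_pre_le) (auto simp: c_def N_def)
      moreover have "(s - (c + r)) * (16 * q ^ j) = \<delta> * (16 * q ^ j)" using s by simp
      ultimately have "?u (set (take s alt)) + \<delta> * (24 * q ^ j) \<le> ?u (pre s) + \<delta> * (16 * q ^ j) + ?L"
        by linarith
      thus ?thesis using 3 by (simp add: algebra_simps)
    next
      case 4
      define r where "r = s - T"
      have s: "s = T + r" using 4 by (simp add: r_def)
      have cT: "c + \<delta> \<le> T" using Tc \<delta> T(1) by linarith
      have P: "pre s = set ys \<union> set zs \<union> set (take r ws)"
        using len s T(1) by (simp add: xs c_def Un_assoc)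
      have "set (take s alt) \<supseteq> set ys \<union> set rs \<union> set (filter (\<lambda>z. z \<notin> X) zs)
          \<union> set (take r (filter (\<lambda>z. z \<notin> R) ws))"
        using s len lrs lz cT by (auto simp: alt_def)
      hence "(pre s \<union> R) - X \<subseteq> set (take s alt)"
        using set_take_filter[of r ws R] P rs(1) by auto
      hence "?u (set (take s alt)) \<le> ?u ((pre s \<union> R) - X)"
        by (rule card_unc_antimono[OF finite_E])
      also have "\<dots> \<le> ?u (pre s) + ?L" using exch[of s] cT s by simp
      finally show ?thesis using 4 cT by simp
    qed
  qed
  have cT: "c + \<delta> \<le> T" "T \<le> N" using Tc \<delta> T by (simp_all add: N_def)
  have sum_if: "(\<Sum>s<N. if l \<le> s \<and> s < h then K else 0) = (h - l) * K" if "h \<le> N" for l h K :: nat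
  proof -
    have "{..<N} \<inter> {s. l \<le> s \<and> s < h} = {l..<h}" using that by auto
    thus ?thesis by (simp add: sum.If_cases)
  qed
  have "(\<Sum>s<N. ?u (set (take s alt)) + (if c + \<delta> \<le> s \<and> s < T then 8 * q ^ j * \<delta> else 0))
      \<le> (\<Sum>s<N. ?u (pre s) + ?L + (if c \<le> s \<and> s < c + \<delta> then 16 * q ^ j * \<delta> else 0))"
    by (rule sum_mono, rule step, simp)
  hence "list_cost E alt + (T - (c + \<delta>)) * (8 * q ^ j * \<delta>) \<le> list_cost E xs + N * ?L + \<delta> * (16 * q ^ j * \<delta>)"
    using cT sum_if[of T "c + \<delta>"] sum_if[of "c + \<delta>" c]
    by (simp add: list_cost_def lalt N_def[symmetric] sum.distrib)
  moreover have "list_cost E xs \<le> list_cost E alt" using opt alt by (simp add: opt_list_def)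
  ultimately have "(T - (c + \<delta>)) * (8 * q ^ j * \<delta>) \<le> N * ?L + \<delta> * (16 * q ^ j * \<delta>)"
    by linarith
  hence "\<delta> * ((T - (c + \<delta>)) * (8 * q ^ j)) \<le> \<delta> * (N * low j + 16 * q ^ j * \<delta>)"
    by (simp add: algebra_simps)
  hence main: "(T - (c + \<delta>)) * (8 * q ^ j) \<le> N * low j + 16 * q ^ j * \<delta>" using \<delta>(1) by simp
  \<comment> \<open>Since \<open>\<delta> \<le> q ^ j\<close> and \<open>8 * q ^ j \<le> D\<close>,
    the \<open>8 * \<delta>\<close> missing in the win and the \<open>16 * \<delta>\<close> paid for
    the insertion add up to at most \<open>3 * D\<close>, which leaves \<open>5 * D\<close> out of
    \<open>8 * D\<close>.\<close>
  define D where "D = T - c"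
  have D: "24 * \<delta> \<le> 3 * D" "T - (c + \<delta>) + \<delta> = D" using Tc \<delta> cT by (simp_all add: D_def)
  have "8 * D * q ^ j = (T - (c + \<delta>)) * (8 * q ^ j) + 8 * \<delta> * q ^ j"
    using D(2) by (simp add: algebra_simps flip: D(2))
  hence "8 * D * q ^ j \<le> N * low j + 24 * \<delta> * q ^ j" using main by (simp add: mult_ac)
  moreover have "24 * \<delta> * q ^ j \<le> 3 * D * q ^ j" using D(1) by (rule mult_le_mono1)
  ultimately have "5 * D * q ^ j \<le> N * low j" by linarith
  hence "q * (5 * D * q ^ j) \<le> q * (N * low j)" by (rule mult_le_mono2)
  also have "\<dots> = N * (q * low j)" by simp
  also have "\<dots> \<le> N * (2 * q ^ j)" using q_low_le by (rule mult_le_mono2)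
  finally have "q ^ j * (5 * (q * D)) \<le> q ^ j * (2 * N)" by (simp add: algebra_simps)
  hence "5 * (q * D) \<le> 2 * N" using q_ge_2 by simp
  thus ?thesis unfolding D_def c_def N_def by linarith
qed

section \<open>Counting the vertices that miss the schedule\<close>

lemma card_deficient_le:
  assumes j: "j < t"
  shows "q * card {a \<in> A. full (Suc j) a \<and> \<not> full j a} \<le> 4 * length xs"
proof -
  let ?D = "{a \<in> A. full (Suc j) a \<and> \<not> full j a}"
  define T' where "T' = cut j + length xs div q"
  define W where "W = pre T' - pre (cut j)"
  have q0: "0 < q" using q_ge_2 by simp
  have "pre T' = pre (cut j) \<union> set (take (length xs div q) (drop (cut j) xs))"
    by (simp add: T'_def take_add)
  hence "W \<subseteq> set (take (length xs div q) (drop (cut j) xs))" by (auto simp: W_def)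
  hence "card W \<le> card (set (take (length xs div q) (drop (cut j) xs)))" by (intro card_mono) auto
  also have "\<dots> \<le> length (take (length xs div q) (drop (cut j) xs))" by (rule card_length)
  finally have W: "card W \<le> length xs div q" by simp
  \<comment> \<open>All deficient blocks of level \<open>j\<close> spend a quarter of their
    \<open>A\<close>-side in the same short stretch \<open>W\<close> after \<open>cut j\<close>, and
    these \<open>A\<close>-sides are equal or disjoint.\<close>
  have "card ?D * (8 * q ^ j) \<le> card W * (32 * q ^ j)"
  proof (rule double_count_le)
    fix a assume "a \<in> ?D"
    hence a: "a \<in> A" "full (Suc j) a" "\<not> full j a" by auto
    have ne: "Bb j a - pre (cut j) \<noteq> {}"
    proof
      assume "Bb j a - pre (cut j) = {}"
      hence "full j a" using a(2) unfolding full_def by (metis Diff_eq_empty_iff Suc_leI le_neq_implies_less)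
      thus False using a(3) by simp
    qed
    obtain T where T: "cut j \<le> T" "T \<le> length xs" "card (Ab j a \<inter> pre T) = 8 * q ^ j"
        "(Bb j a - pre (cut j)) \<inter> pre T = {}" "Ab j a \<inter> pre (cut j) = {}"
      using deficient_window[OF j a(1,2) refl ne] by blast
    have "q * (T - cut j) \<le> length xs" by (rule window_short[OF j a(1,2) refl ne T])
    hence "T - cut j \<le> length xs div q"
      using q0 by (simp add: less_eq_div_iff_mult_less_eq mult.commute)
    hence "pre T \<subseteq> pre T'" by (intro pre_mono) (simp add: T'_def)
    hence "Ab j a \<inter> pre T \<subseteq> Ab j a \<inter> W" using T(5) by (auto simp: W_def)
    hence "card (Ab j a \<inter> pre T) \<le> card (Ab j a \<inter> W)"
      by (intro card_mono) (auto simp: finite_Ab)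
    thus "8 * q ^ j \<le> card (Ab j a \<inter> W)" using T(3) by simp
  next
    fix a w assume aw: "a \<in> ?D" "w \<in> Ab j a"
    have "{a' \<in> ?D. w \<in> Ab j a'} \<subseteq> Ab j a" using aw by (auto simp: Ab_def)
    hence "card {a' \<in> ?D. w \<in> Ab j a'} \<le> card (Ab j a)" by (intro card_mono finite_Ab)
    thus "card {a' \<in> ?D. w \<in> Ab j a'} \<le> 32 * q ^ j"
      using card_blk_A[OF j, of a] aw by (simp add: Ab_def)
  qed (simp_all add: finite_A W_def)
  hence "8 * q ^ j * card ?D \<le> 8 * q ^ j * (4 * card W)" by (simp add: mult_ac)
  moreover have "0 < 8 * q ^ j" using q0 by simp
  ultimately have "card ?D \<le> 4 * card W" by (simp only: mult_le_cancel1)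
  hence "q * card ?D \<le> q * (4 * (length xs div q))" using W by (intro mult_le_mono2) linarith
  also have "\<dots> \<le> 4 * length xs" using times_div_less_eq_dividend[of q "length xs"] by simp
  finally show ?thesis .
qed

text \<open>A vertex that is not \<open>full 0\<close> fails just below the least level
  \<open>m\<close> with \<open>full m a\<close>. Each of the \<open>t\<close> levels accounts for at
  most \<open>4 * length xs / q\<close> vertices, and by \<open>q_ge\<close> this is at most half of
  \<open>A\<close> in total.\<close>

lemma card_full_ge: "16 * q ^ t \<le> card {a \<in> A. full 0 a}"
proof -
  let ?G = "{a \<in> A. full 0 a}"
  let ?D = "\<lambda>j. {a \<in> A. full (Suc j) a \<and> \<not> full j a}"
  have "A \<subseteq> ?G \<union> (\<Union>j<t. ?D j)"
  proof
    fix a assume a: "a \<in> A"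
    have "full t a" by (simp add: full_def)
    show "a \<in> ?G \<union> (\<Union>j<t. ?D j)"
    proof (cases "full 0 a")
      case False
      define m where "m = (LEAST m. full m a)"
      have m: "full m a" unfolding m_def using \<open>full t a\<close> by (rule LeastI)
      have mt: "m \<le> t" unfolding m_def using \<open>full t a\<close> by (rule Least_le)
      obtain j where j: "m = Suc j" using m False by (cases m) auto
      have "\<not> full j a" using not_less_Least[of j "\<lambda>m. full m a"] j m_def by simp
      thus ?thesis using a m mt j by auto
    qed (use a in simp)
  qed
  hence "card A \<le> card (?G \<union> (\<Union>j<t. ?D j))" by (intro card_mono) (auto simp: finite_A)
  also have "\<dots> \<le> card ?G + card (\<Union>j<t. ?D j)" by (rule card_Un_le)
  also have "card (\<Union>j<t. ?D j) \<le> (\<Sum>j<t. card (?D j))" by (rule card_UN_le) simp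
  finally have le: "32 * q ^ t \<le> card ?G + (\<Sum>j<t. card (?D j))" by (simp add: card_A)
  have "q * (\<Sum>j<t. card (?D j)) = (\<Sum>j<t. q * card (?D j))" by (rule sum_distrib_left)
  also have "\<dots> \<le> (\<Sum>j<t. 4 * length xs)"
    using card_deficient_le by (intro sum_mono) simp
  also have "\<dots> = 4 * (t * (32 + t)) * q ^ t" by (simp add: length_xs)
  also have "\<dots> \<le> 4 * (4 * q) * q ^ t" using q_ge by (intro mult_le_mono1 mult_le_mono2)
  also have "\<dots> = q * (16 * q ^ t)" by simp
  finally have "(\<Sum>j<t. card (?D j)) \<le> 16 * q ^ t" using q_ge_2 by simp
  thus ?thesis using le by linarith
qed

text \<open>Each of the \<open>16 * q ^ t\<close> vertices on schedule forces \<open>q ^ j\<close>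
  vertices of \<open>B j\<close> to be used, and each of these is shared by at most
  \<open>32 * q ^ j\<close> vertices of \<open>A\<close>. So half of \<open>B j\<close> is used, for
  every \<open>j < t\<close>.\<close>

lemma card_pre_cut_ge: "t * q ^ t \<le> 2 * card (pre (cut 0))"
proof -
  let ?G = "{a \<in> A. full 0 a}"
  have ge: "q ^ t \<le> 2 * card (B j \<inter> pre (cut 0))" if j: "j < t" for j
  proof -
    have "card ?G * q ^ j \<le> card (B j \<inter> pre (cut 0)) * (32 * q ^ j)"
    proof (rule double_count_le)
      fix a assume a: "a \<in> ?G"
      have "Bb j a \<subseteq> pre (cut j)" using a j by (simp add: full_def)
      also have "\<dots> \<subseteq> pre (cut 0)" by (intro pre_mono cut_antimono) simp
      finally have "Bb j a \<inter> (B j \<inter> pre (cut 0)) = Bb j a" by (auto simp: Bb_def)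
      thus "q ^ j \<le> card (Bb j a \<inter> (B j \<inter> pre (cut 0)))"
        using card_blk_B[OF j, of a] a by (simp add: Bb_def)
    next
      fix a w assume aw: "a \<in> ?G" "w \<in> Bb j a"
      have "{a' \<in> ?G. w \<in> Bb j a'} \<subseteq> Ab j a" using aw by (auto simp: Ab_def Bb_def)
      hence "card {a' \<in> ?G. w \<in> Bb j a'} \<le> card (Ab j a)" by (intro card_mono finite_Ab)
      thus "card {a' \<in> ?G. w \<in> Bb j a'} \<le> 32 * q ^ j"
        using card_blk_A[OF j, of a] aw by (simp add: Ab_def)
    qed (simp_all add: finite_A)
    hence "q ^ j * card ?G \<le> q ^ j * (32 * card (B j \<inter> pre (cut 0)))" by (simp add: mult_ac)
    hence "card ?G \<le> 32 * card (B j \<inter> pre (cut 0))" using q_ge_2 by simp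
    thus ?thesis using card_full_ge by linarith
  qed
  have "card (\<Union>j<t. B j \<inter> pre (cut 0)) = (\<Sum>j<t. card (B j \<inter> pre (cut 0)))"
    using disj_BB by (intro card_UN_disjoint) (auto simp: disjoint_iff)
  moreover have "card (\<Union>j<t. B j \<inter> pre (cut 0)) \<le> card (pre (cut 0))"
    by (intro card_mono) auto
  ultimately have "(\<Sum>j<t. 2 * card (B j \<inter> pre (cut 0))) \<le> 2 * card (pre (cut 0))"
    by (simp add: sum_distrib_left[symmetric])
  moreover have "(\<Sum>j<t. q ^ t) \<le> (\<Sum>j<t. 2 * card (B j \<inter> pre (cut 0)))"
    using ge by (intro sum_mono) simp
  ultimately show ?thesis by simp
qed

end

lemma (in block_graph) msvc_number_ge: "t * q ^ t \<le> 2 * msvc_number V E"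
proof -
  obtain \<sigma> where \<sigma>: "min_sum_vertex_cover V E \<sigma>" using msvc_exists[OF finite_V] by blast
  obtain xs where xs: "opt_list V E xs" and pre: "\<And>s. set (take s xs) = {v \<in> V. \<sigma> v \<le> s}"
    using opt_list_of_msvc[OF finite_V finite_E edge_in_V \<sigma>] by metis
  interpret optimal_block_graph A B blk q t xs by unfold_locales (rule xs)
  have "pre (cut 0) \<subseteq> used_vertices V E \<sigma>"
  proof (cases "cut 0")
    case (Suc s)
    hence s: "s < cut 0" "s < length xs" using cut_le[of 0] by simp_all
    \<comment> \<open>The last step before \<open>cut 0\<close> still gains at least 16, so some
      edge is uncovered until then and its cover time is at least
      \<open>Suc s = cut 0\<close>.\<close>
    have "card {e \<in> unc E (pre s). xs ! s \<in> e} \<noteq> 0"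
      using gain_before_cut[OF s(1)] by (simp add: gain_def)
    hence "{e \<in> unc E (pre s). xs ! s \<in> e} \<noteq> {}" by (metis card.empty)
    then obtain e where e: "e \<in> E" "e \<inter> pre s = {}" unfolding unc_def by blast
    have "finite e" "e \<noteq> {}" "e \<subseteq> V" using edge_in_V[OF e(1)] finite_V finite_subset by auto
    hence "Suc s \<le> cover_time \<sigma> e"
      unfolding cover_time_def using e(2) pre[of s] by (subst Min_ge_iff) (auto simp: not_less_eq_eq)
    also have "\<dots> \<le> Max (cover_time \<sigma> ` E)" using e(1) finite_E by (intro Max_ge) auto
    finally show ?thesis using pre[of "cut 0"] Suc by (auto simp: used_vertices_def)
  qed simp
  hence "card (pre (cut 0)) \<le> card (used_vertices V E \<sigma>)"
    using finite_V by (intro card_mono) (auto simp: used_vertices_def)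
  also have "\<dots> \<le> msvc_number V E"
    unfolding msvc_number_def
  proof (rule Max_ge)
    have "{card (used_vertices V E \<sigma>) | \<sigma>. min_sum_vertex_cover V E \<sigma>} \<subseteq> {..card V}"
      using finite_V by (auto simp: used_vertices_def intro: card_mono)
    thus "finite {card (used_vertices V E \<sigma>) | \<sigma>. min_sum_vertex_cover V E \<sigma>}"
      using finite_subset by blast
  qed (use \<sigma> in blast)
  finally show ?thesis using card_pre_cut_ge by linarith
qed

section \<open>Instantiation and asymptotics\<close>

lemma card_div_class:
  assumes "0 < d" "(y :: nat) < d * m"
  shows "card {x \<in> {..<d * m}. x div d = y div d} = d"
proof -
  define k where "k = y div d"
  have "k < m" using assms by (simp add: k_def less_mult_imp_div_less mult.commute)
  hence le: "d * k + d \<le> d * m" by (metis Suc_leI mult_Suc_right mult_le_mono2 add.commute)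
  have iff: "x div d = k \<longleftrightarrow> d * k \<le> x \<and> x < d * k + d" for x
  proof -
    have "x div d = k \<longleftrightarrow> k \<le> x div d \<and> x div d < Suc k" by auto
    thus ?thesis
      using assms(1)
      by (simp only: less_eq_div_iff_mult_less_eq div_less_iff_less_mult) (simp add: algebra_simps)
  qed
  have "{x \<in> {..<d * m}. x div d = k} = {d * k..<d * k + d}"
    unfolding iff using le by (intro set_eqI) (simp, linarith)
  thus ?thesis by (simp add: k_def)
qed

definition nat_A :: "nat \<Rightarrow> nat \<Rightarrow> nat set" where
  "nat_A q t = (\<lambda>x. prod_encode (0, x)) ` {..<32 * q ^ t}"

definition nat_B :: "nat \<Rightarrow> nat \<Rightarrow> nat \<Rightarrow> nat set" where
  "nat_B q t j = (\<lambda>x. prod_encode (Suc j, x)) ` {..<q ^ t}"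

definition nat_blk :: "nat \<Rightarrow> nat \<Rightarrow> nat \<Rightarrow> nat" where
  "nat_blk q j v = (case prod_decode v of (i, x) \<Rightarrow> if i = 0 then x div (32 * q ^ j) else x div q ^ j)"

lemma block_graph_nat:
  assumes t: "0 < t" and qt: "t * (32 + t) \<le> 4 * q"
  shows "block_graph (nat_A q t) (nat_B q t) (nat_blk q) q t"
proof -
  have inj: "inj_on (\<lambda>x. prod_encode (i, x)) S" for i S by (simp add: inj_on_def)
  have q0: "0 < q" using t qt by (cases q) auto
  have split: "q ^ t = q ^ j * q ^ (t - j)" if "j < t" for j
    using that by (simp flip: power_add)
  have blkA: "nat_blk q j (prod_encode (0, x)) = x div (32 * q ^ j)"
    and blkB: "nat_blk q j (prod_encode (Suc i, x)) = x div q ^ j" for i j x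
    by (simp_all add: nat_blk_def)
  show ?thesis
  proof
    fix j a assume j: "j < t" and "a \<in> nat_A q t"
    then obtain y where y: "y < 32 * q ^ t" "a = prod_encode (0, y)" by (auto simp: nat_A_def)
    have n: "32 * q ^ t = 32 * q ^ j * q ^ (t - j)" using split[OF j] by simp
    have "{a' \<in> nat_A q t. nat_blk q j a' = nat_blk q j a} =
        (\<lambda>x. prod_encode (0, x)) ` {x \<in> {..<32 * q ^ t}. x div (32 * q ^ j) = y div (32 * q ^ j)}"
      by (auto simp: nat_A_def blkA y)
    thus "card {a' \<in> nat_A q t. nat_blk q j a' = nat_blk q j a} = 32 * q ^ j"
      using card_div_class[of "32 * q ^ j" y "q ^ (t - j)"] y(1) q0 unfolding n by (simp add: card_image inj)
    \<comment> \<open>Position \<open>x0\<close> faces \<open>y\<close> at all levels at once,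
      because dividing by \<open>32 * q ^ j\<close> is dividing by 32 and then by
      \<open>q ^ j\<close>.\<close>
    define x0 where "x0 = y div 32"
    have x0: "x0 < q ^ t" using y(1) by (simp add: x0_def less_mult_imp_div_less mult.commute)
    have "{b \<in> nat_B q t j. nat_blk q j b = nat_blk q j a} =
        (\<lambda>x. prod_encode (Suc j, x)) ` {x \<in> {..<q ^ t}. x div q ^ j = x0 div q ^ j}"
      by (auto simp: nat_B_def blkA blkB y x0_def div_mult2_eq)
    thus "card {b \<in> nat_B q t j. nat_blk q j b = nat_blk q j a} = q ^ j"
      using card_div_class[of "q ^ j" x0 "q ^ (t - j)"] x0 q0 unfolding split[OF j] by (simp add: card_image inj)
  next
    fix i j a a' assume ij: "i \<le> j" and a: "a \<in> nat_A q t" "a' \<in> nat_A q t"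
      and eq: "nat_blk q i a = nat_blk q i a'"
    obtain x x' where x: "a = prod_encode (0, x)" "a' = prod_encode (0, x')"
      using a by (auto simp: nat_A_def)
    have "q ^ j = q ^ i * q ^ (j - i)" using ij by (simp flip: power_add)
    hence "nat_blk q j (prod_encode (0, x)) = nat_blk q i (prod_encode (0, x)) div q ^ (j - i)" for x
      by (simp add: blkA div_mult2_eq flip: mult.assoc)
    thus "nat_blk q j a = nat_blk q j a'" using eq x by simp
  qed (auto simp: nat_A_def nat_B_def card_image inj t qt)
qed

text \<open>With \<open>n = (t\<^sup>2) ^ t\<close> one has \<open>ln n = 2 * t * ln t\<close>.
  Since \<open>n \<ge> 32\<close>, \<open>\<tau>\<close> is at most \<open>n * n\<close>, so
  \<open>ln \<tau>\<close> lies between \<open>t\<close> and \<open>4 * t * ln t\<close>, and the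
  quotient of logarithms is at most \<open>4 * t\<close>.\<close>

lemma tau_log_tau_over_loglog_tau_le:
  fixes t :: nat and \<tau> :: real
  assumes t: "11 \<le> t" and \<tau>: "real ((t\<^sup>2) ^ t) \<le> \<tau>" "\<tau> \<le> 32 * real ((t\<^sup>2) ^ t)"
  shows "\<tau> * ln \<tau> / ln (ln \<tau>) \<le> 128 * (real t * real ((t\<^sup>2) ^ t))"
proof -
  define n where "n = real ((t\<^sup>2) ^ t)"
  have "exp 1 \<le> real t" using exp_le t by linarith
  hence lt: "1 \<le> ln (real t)" using t by (subst ln_ge_iff) auto
  have ln_n: "ln n = 2 * real t * ln (real t)"
    using t by (simp add: n_def ln_realpow flip: power_mult)
  have "(11::nat)\<^sup>2 \<le> t\<^sup>2" using t by (intro power_mono) auto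
  also have "\<dots> \<le> (t\<^sup>2) ^ t" using t by (intro self_le_power) auto
  finally have "32 \<le> (t\<^sup>2) ^ t" by simp
  hence n32: "32 \<le> n" unfolding n_def by (metis of_nat_le_iff of_nat_numeral)
  have \<tau>n: "n \<le> \<tau>" "\<tau> \<le> 32 * n" using \<tau> by (simp_all add: n_def)
  have "ln \<tau> \<le> ln (n * n)" using \<tau>n n32 by (subst ln_le_cancel_iff) (auto intro: order_trans mult_right_mono)
  also have "\<dots> = 4 * real t * ln (real t)" using n32 ln_n by (simp add: ln_mult)
  finally have up: "ln \<tau> \<le> 4 * real t * ln (real t)" .
  have "ln n \<le> ln \<tau>" using \<tau>n n32 by simp
  moreover have "real t * 1 \<le> real t * (2 * ln (real t))" using lt by (intro mult_left_mono) auto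
  ultimately have "real t \<le> ln \<tau>" using ln_n by simp
  hence lo: "ln (real t) \<le> ln (ln \<tau>)" using t by simp
  have "\<tau> * ln \<tau> / ln (ln \<tau>) \<le> (32 * n) * (4 * real t * ln (real t)) / ln (real t)"
    using \<tau>n n32 lt lo up \<open>real t \<le> ln \<tau>\<close> by (intro frac_le mult_mono) auto
  also have "\<dots> = 128 * (real t * n)" using lt by simp
  finally show ?thesis by (simp add: n_def)
qed

theorem theorem3:
  shows "\<exists>c::real. c > 0 \<and>
    (\<forall>k::nat. \<exists>(V :: nat set) (E :: nat set set).
       bipartite_graph V E \<and> vc_number V E \<ge> k \<and>
       real (msvc_number V E) \<ge>
         c * (real (vc_number V E) * ln (real (vc_number V E)) / ln (ln (real (vc_number V E)))))"
\<comment> \<open>The constant combines 128 from the estimate of the logarithms with the factor 2 of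
  \<open>msvc_number_ge\<close>.\<close>
proof (intro exI[of _ "1 / 256 :: real"] conjI allI)
  fix k :: nat
  \<comment> \<open>11 is the least \<open>t\<close> with \<open>32 + t \<le> 4 * t\<close>, which
    is what \<open>q_ge\<close> needs for \<open>q = t\<^sup>2\<close>.\<close>
  define t where "t = max 11 k"
  have t: "11 \<le> t" "k \<le> t" by (simp_all add: t_def)
  have "t * (32 + t) \<le> t * (4 * t)" using t(1) by (intro mult_le_mono2) simp
  hence "t * (32 + t) \<le> 4 * t\<^sup>2" by (simp add: power2_eq_square)
  then interpret block_graph "nat_A (t\<^sup>2) t" "nat_B (t\<^sup>2) t" "nat_blk (t\<^sup>2)" "t\<^sup>2" t
    using t(1) by (intro block_graph_nat) auto
  have "k \<le> t\<^sup>2" using t by (simp add: power2_eq_square le_trans[OF t(2)])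
  also have "\<dots> \<le> (t\<^sup>2) ^ t" using t by (intro self_le_power) auto
  also note vc_number_bounds(1)
  finally have "k \<le> vc_number V E" .
  moreover have "1 / 256 * (real (vc_number V E) * ln (real (vc_number V E)) / ln (ln (real (vc_number V E))))
      \<le> real (msvc_number V E)"
  proof -
    have "real (vc_number V E) * ln (real (vc_number V E)) / ln (ln (real (vc_number V E)))
        \<le> 128 * (real t * real ((t\<^sup>2) ^ t))"
      using vc_number_bounds[THEN of_nat_mono[where ?'a = real]]
      by (intro tau_log_tau_over_loglog_tau_le t(1)) simp_all
    moreover have "real (t * (t\<^sup>2) ^ t) \<le> real (2 * msvc_number V E)"
      using msvc_number_ge by (rule of_nat_mono)
    moreover have "y \<le> 128 * z \<Longrightarrow> z \<le> 2 * m \<Longrightarrow> 1 / 256 * y \<le> m" for y z m :: real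
      by simp
    ultimately show ?thesis unfolding of_nat_mult of_nat_numeral by blast
  qed
  ultimately show "\<exists>(V :: nat set) (E :: nat set set).
       bipartite_graph V E \<and> vc_number V E \<ge> k \<and>
       real (msvc_number V E) \<ge>
         1 / 256 * (real (vc_number V E) * ln (real (vc_number V E)) / ln (ln (real (vc_number V E))))"
    using bipartite by blast
qed simp

end
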